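(* Let $\mathbb{X}$ be a real reflexive Banach space and $\mathbb{Y}$ any real Banach space. Let $T,A:\mathbb{X}\to\mathbb{Y}$ be compact linear operators such that $T\perp_B A$. Let $\mathcal{O}$ denote the collection of all s.i.p. on $\mathbb{Y}$. Then \begin{align*} \|T\|&=\sup\{[Tx,y]:x\in S_{\mathbb{X}},\ y\in S_{\mathbb{Y}},\ [\cdot,\cdot]\in\mathcal{O},\ [Ax,y]\ge 0\}\\ &=\sup\{[Tx,y]:x\in S_{\mathbb{X}},\ y\in S_{\mathbb{Y}},\ [\cdot,\cdot]\in\mathcal{O},\ [Ax,y]\le 0\}. \end{align*}
   Context: All normed spaces are real; $S_{\mathbb{X}}=\{x\in\mathbb{X}:\|x\|=1\}$ and similarly $S_{\mathbb{Y}}$. $T\perp_B A$ (Birkhoff-James orthogonality) means $\|T+\lambda A\|\ge\|T\|$ for all $\lambda\in\mathbb{R}$, in the operator norm. A semi-inner-product (s.i.p.) on a real normed space $\mathbb{Y}$ is a function $[\cdot,\cdot]:\mathbb{Y}\times\mathbb{Y}\to\mathbb{R}$ such that for all $\alpha,\beta\in\mathbb{R}$ and $x,y,z\in\mathbb{Y}$: (a) $[\alpha x+\beta y,z]=\alpha[x,z]+\beta[y,z]$; (b) $[x,x]>0$ whenever $x\ne 0$; (c) $|[x,y]|^2\le[x,x][y,y]$; (d) $[x,\alpha y]=\alpha[x,y]$. Every s.i.p. is assumed compatible with the norm: $[x,x]=\|x\|^2$ for all $x$. In the suprema, the same s.i.p. is used in $[Tx,y]$ and in the constraint on $[Ax,y]$.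 *)

theory Defs
  imports "HOL-Analysis.Analysis"
begin

definition birkhoff_james_orthogonal :: "'a::real_normed_vector \<Rightarrow> 'a \<Rightarrow> bool"
    (infix \<open>\<bottom>\<^sub>B\<close> 50)
  where "x \<bottom>\<^sub>B y \<longleftrightarrow> (\<forall>c::real. norm (x + c *\<^sub>R y) \<ge> norm x)"

lift_definition bidual_embedding ::
    "'a::real_normed_vector \<Rightarrow> (('a \<Rightarrow>\<^sub>L real) \<Rightarrow>\<^sub>L real)"
  is "\<lambda>x f. blinfun_apply f x"
  by (rule blinfun.bounded_linear_left)

text \<open>Reflexivity is surjectivity of this canonical map itself; an arbitrary isometric
  isomorphism onto the bidual would not be enough.\<close>

definition reflexive_space :: "'a::real_normed_vector itself \<Rightarrow> bool"
  where "reflexive_space _ \<longleftrightarrow>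
    surj (bidual_embedding :: 'a \<Rightarrow> (('a \<Rightarrow>\<^sub>L real) \<Rightarrow>\<^sub>L real))"

definition compact_operator ::
    "('a::real_normed_vector \<Rightarrow>\<^sub>L 'b::real_normed_vector) \<Rightarrow> bool"
  where "compact_operator T \<longleftrightarrow>
    (\<forall>S. bounded S \<longrightarrow> compact (closure (blinfun_apply T ` S)))"

definition semi_inner_product :: "('a::real_vector \<Rightarrow> 'a \<Rightarrow> real) \<Rightarrow> bool"
  where "semi_inner_product s \<longleftrightarrow>
    (\<forall>a b x y z. s (a *\<^sub>R x + b *\<^sub>R y) z = a * s x z + b * s y z) \<and>
    (\<forall>x. x \<noteq> 0 \<longrightarrow> s x x > 0) \<and>
    (\<forall>x y. \<bar>s x y\<bar>\<^sup>2 \<le> s x x * s y y) \<and>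
    (\<forall>a x y. s x (a *\<^sub>R y) = a * s x y)"

definition compatible_sips :: "('a::real_normed_vector \<Rightarrow> 'a \<Rightarrow> real) set"
  where "compatible_sips = {s. semi_inner_product s \<and> (\<forall>x. s x x = (norm x)\<^sup>2)}"

end

theory Submission
  imports Defs
begin

text \<open>
  By orthogonality, \<open>T + cA\<close> with small \<open>c > 0\<close> has norm at least \<open>\<parallel>T\<parallel>\<close>, and being compact on a
  reflexive space it attains its norm at some unit \<open>x\<close>. If \<open>f\<close> is a support functional at
  \<open>(T + cA)x\<close>, then \<open>f(Tx) + c f(Ax) \<ge> \<parallel>T\<parallel>\<close> forces both \<open>f(Ax) \<ge> 0\<close> and
  \<open>f(Tx) \<ge> \<parallel>T\<parallel> - c\<parallel>A\<parallel>\<close>, and \<open>f\<close> extends to a compatible s.i.p.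

  Norm attainment does not need weak compactness: if \<open>T x\<^sub>n\<close> converges to \<open>z\<close> with all \<open>x\<^sub>n\<close> in the
  unit ball, then \<open>g \<circ> T \<mapsto> g(z)\<close> is bounded by the norm, so by Hahn-Banach it extends to the dual,
  and by reflexivity the extension is evaluation at a point of the unit ball that \<open>T\<close> maps to \<open>z\<close>.
\<close>

section \<open>The Hahn-Banach theorem\<close>

text \<open>Homogeneity is asked only as an inequality for positive factors, which is easy to pass
  through infima. Scaling back by the inverse factor recovers equality.\<close>

definition sublinear :: "('a::real_vector \<Rightarrow> real) \<Rightarrow> bool"
  where "sublinear p \<longleftrightarrow>
    (\<forall>x y. p (x + y) \<le> p x + p y) \<and> (\<forall>c>0. \<forall>x. p (c *\<^sub>R x) \<le> c * p x)"

lemma sublinear_add: "sublinear p \<Longrightarrow> p (x + y) \<le> p x + p y"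
  by (simp add: sublinear_def)

lemma sublinear_zero:
  assumes "sublinear p"
  shows "p 0 = 0"
proof -
  \<comment> \<open>The factor 2 gives \<open>0 \<le> p 0\<close>, the factor 1/2 gives
    \<open>p 0 \<le> 0\<close>.\<close>
  have "p (2 *\<^sub>R 0) \<le> 2 * p 0" "p ((1/2) *\<^sub>R 0) \<le> (1/2) * p 0"
    using assms unfolding sublinear_def by (metis zero_less_numeral, metis half_gt_zero zero_less_one)
  then show ?thesis by simp
qed

lemma sublinear_scale:
  assumes "sublinear p" "c \<ge> 0"
  shows "p (c *\<^sub>R x) = c * p x"
proof (cases "c = 0")
  case True
  then show ?thesis using sublinear_zero[OF assms(1)] by simp
next
  case False
  then have c: "c > 0" using assms(2) by simp
  have le: "p (c *\<^sub>R x) \<le> c * p x" if "c > 0" for c x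
    using assms(1) that by (simp add: sublinear_def)
  have "p (inverse c *\<^sub>R (c *\<^sub>R x)) \<le> inverse c * p (c *\<^sub>R x)"
    using c by (intro le) simp
  then have "c * p x \<le> p (c *\<^sub>R x)"
    using c by (simp add: field_simps)
  with le[OF c, of x] show ?thesis by simp
qed

lemma sublinear_neg_ge:
  assumes "sublinear p"
  shows "- p (- x) \<le> p x"
  using sublinear_add[OF assms, of x "- x"] sublinear_zero[OF assms] by simp

lemma sublinear_norm: "sublinear norm"
  by (simp add: sublinear_def norm_triangle_ineq)

text \<open>A pair \<open>(m, r)\<close> in the cone encodes the demand \<open>f m \<ge> r\<close>
  on linear functionals \<open>f\<close>: whatever lies below \<open>q\<close> meets it, since
  \<open>f (- m) \<le> - r\<close>. The witness is the infimum of \<open>p (x + m) - r\<close> over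
  the cone. A ray serves to prove linearity of minimal functionals, a subspace to extend a
  functional.\<close>

lemma sublinear_below_cone:
  fixes p :: "'a::real_vector \<Rightarrow> real"
  assumes p: "sublinear p"
    and W0: "(0, 0) \<in> W"
    and Wadd: "\<And>u v. u \<in> W \<Longrightarrow> v \<in> W \<Longrightarrow> u + v \<in> W"
    and Wscale: "\<And>c u. c > 0 \<Longrightarrow> u \<in> W \<Longrightarrow> c *\<^sub>R u \<in> W"
    and le: "\<And>m r. (m, r) \<in> W \<Longrightarrow> r \<le> p m"
  obtains q where "sublinear q" "\<And>x. q x \<le> p x" "\<And>m r. (m, r) \<in> W \<Longrightarrow> q (- m) \<le> - r"
proof
  define h where "h x u = p (x + fst u) - snd u" for x u
  define q where "q x = (INF u\<in>W. h x u)" for x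
  \<comment> \<open>This bound is independent of \<open>u\<close>, so the infimum is finite.\<close>
  have lower: "- p (- x) \<le> h x u" if "u \<in> W" for x u
  proof -
    have "p (fst u) \<le> p (x + fst u) + p (- x)"
      using sublinear_add[OF p, of "x + fst u" "- x"] by simp
    moreover have "snd u \<le> p (fst u)" using le that by simp
    ultimately show ?thesis by (simp add: h_def)
  qed
  have bdd: "bdd_below (h x ` W)" for x
    using lower by (intro bdd_belowI[of _ "- p (- x)"]) auto
  have q_le: "q x \<le> h x u" if "u \<in> W" for x u
    unfolding q_def using that bdd by (intro cINF_lower)
  have q_ge: "a \<le> q x" if "\<And>u. u \<in> W \<Longrightarrow> a \<le> h x u" for a x
    unfolding q_def using that W0 by (intro cINF_greatest) auto
  have add: "q (x + y) \<le> q x + q y" for x y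
  proof -
    \<comment> \<open>\<open>u + v\<close> competes in the infimum at \<open>x + y\<close>. The
      infima over \<open>u\<close> and \<open>v\<close> are then taken one at a time, as neither
      need be attained.\<close>
    have "q (x + y) - h y v \<le> h x u" if "u \<in> W" "v \<in> W" for u v
    proof -
      have "q (x + y) \<le> h (x + y) (u + v)" using q_le Wadd that by blast
      also have "\<dots> \<le> h x u + h y v"
        using sublinear_add[OF p, of "x + fst u" "y + fst v"]
        by (simp add: h_def algebra_simps)
      finally show ?thesis by simp
    qed
    then have "q (x + y) - h y v \<le> q x" if "v \<in> W" for v
      using q_ge that by blast
    then have "q (x + y) - q x \<le> q y"
      by (intro q_ge) (simp add: algebra_simps)
    then show ?thesis by simp
  qed
  have scale: "q (c *\<^sub>R x) \<le> c * q x" if "c > 0" for c x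
  proof -
    have "q (c *\<^sub>R x) / c \<le> h x u" if "u \<in> W" for u
    proof -
      have "q (c *\<^sub>R x) \<le> h (c *\<^sub>R x) (c *\<^sub>R u)" using q_le Wscale \<open>c > 0\<close> that by blast
      also have "\<dots> = c * h x u"
        using sublinear_scale[OF p, of c "x + fst u"] \<open>c > 0\<close>
        by (simp add: h_def algebra_simps)
      finally show ?thesis using \<open>c > 0\<close> by (simp add: field_simps)
    qed
    then have "q (c *\<^sub>R x) / c \<le> q x" by (rule q_ge)
    then show ?thesis using \<open>c > 0\<close> by (simp add: field_simps)
  qed
  show "sublinear q" using add scale by (simp add: sublinear_def)
  show "q x \<le> p x" for x
    using q_le[OF W0, of x] by (simp add: h_def)
  show "q (- m) \<le> - r" if "(m, r) \<in> W" for m r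
    using q_le[OF that, of "- m"] sublinear_zero[OF p] by (simp add: h_def)
qed

text \<open>The pointwise infimum works: \<open>- p (- x)\<close> bounds it below, and in a chain
  the smaller of \<open>q\<close> and \<open>r\<close> is below both, which gives subadditivity of
  the infimum.\<close>

lemma sublinear_INF_chain:
  fixes C :: "('a::real_vector \<Rightarrow> real) set"
  assumes sub: "\<And>q. q \<in> C \<Longrightarrow> sublinear q" and ne: "C \<noteq> {}"
    and chain: "\<And>q r. q \<in> C \<Longrightarrow> r \<in> C \<Longrightarrow> q \<le> r \<or> r \<le> q"
    and le: "\<And>q. q \<in> C \<Longrightarrow> q \<le> p"
  obtains g where "sublinear g" "\<And>q. q \<in> C \<Longrightarrow> g \<le> q"
proof
  define g where "g x = (INF q\<in>C. q x)" for x
  have "- p (- x) \<le> q x" if "q \<in> C" for q x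
    using sublinear_neg_ge[OF sub[OF that], of x] le_funD[OF le[OF that], of "- x"] by simp
  then have bdd: "bdd_below ((\<lambda>q. q x) ` C)" for x
    by (intro bdd_belowI[of _ "- p (- x)"]) auto
  have g_le: "g x \<le> q x" if "q \<in> C" for x q
    unfolding g_def using that bdd by (intro cINF_lower)
  have g_ge: "a \<le> g x" if "\<And>q. q \<in> C \<Longrightarrow> a \<le> q x" for a x
    unfolding g_def using that ne by (intro cINF_greatest) auto
  show "g \<le> q" if "q \<in> C" for q using g_le that by (simp add: le_fun_def)
  have add: "g (x + y) \<le> g x + g y" for x y
  proof -
    have "g (x + y) - r y \<le> q x" if "q \<in> C" "r \<in> C" for q r
    proof (cases "q \<le> r")
      case True
      then show ?thesis
        using g_le[OF that(1), of "x + y"] sublinear_add[OF sub[OF that(1)], of x y]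
          le_funD[OF True, of y] by simp
    next
      case False
      then have "r \<le> q" using chain that by blast
      then show ?thesis
        using g_le[OF that(2), of "x + y"] sublinear_add[OF sub[OF that(2)], of x y]
          le_funD[OF \<open>r \<le> q\<close>, of x] by simp
    qed
    then have "g (x + y) - r y \<le> g x" if "r \<in> C" for r
      using g_ge that by blast
    then have "g (x + y) - g x \<le> g y"
      by (intro g_ge) (simp add: algebra_simps)
    then show ?thesis by simp
  qed
  have scale: "g (c *\<^sub>R x) \<le> c * g x" if "c > 0" for c x
  proof -
    have "g (c *\<^sub>R x) / c \<le> q x" if "q \<in> C" for q
      using g_le[OF that, of "c *\<^sub>R x"] sublinear_scale[OF sub[OF that], of c x] \<open>c > 0\<close>
      by (simp add: field_simps)
    then have "g (c *\<^sub>R x) / c \<le> g x" by (rule g_ge)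
    then show ?thesis using \<open>c > 0\<close> by (simp add: field_simps)
  qed
  show "sublinear g" using add scale by (simp add: sublinear_def)
qed

text \<open>Lowering \<open>q\<close> along the ray through \<open>a\<close> gives a sublinear
  \<open>r \<le> q\<close> with \<open>r (- a) \<le> - q a\<close>. Minimality makes
  \<open>r\<close> equal to \<open>q\<close>, so \<open>q\<close> is odd, and an odd sublinear
  functional is linear.\<close>

lemma linear_if_minimal_sublinear:
  fixes q :: "'a::real_vector \<Rightarrow> real"
  assumes q: "sublinear q" and min: "\<And>r. sublinear r \<Longrightarrow> r \<le> q \<Longrightarrow> r = q"
  shows "linear q"
proof -
  have neg: "q (- a) = - q a" for a
  proof -
    define W where "W = (\<lambda>t. (t *\<^sub>R a, t * q a)) ` {0..}"
    have W: "(t *\<^sub>R a, t * q a) \<in> W" if "t \<ge> 0" for t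
      using that by (auto simp: W_def)
    have "(0, 0) \<in> W" using W[of 0] by simp
    moreover have "u + v \<in> W" if uv: "u \<in> W" "v \<in> W" for u v
    proof -
      obtain s t where "u = (s *\<^sub>R a, s * q a)" "v = (t *\<^sub>R a, t * q a)" "s \<ge> 0" "t \<ge> 0"
        using uv by (auto simp: W_def)
      then show ?thesis using W[of "s + t"] by (simp add: algebra_simps)
    qed
    moreover have "c *\<^sub>R u \<in> W" if cu: "c > 0" "u \<in> W" for c u
    proof -
      obtain s where "u = (s *\<^sub>R a, s * q a)" "s \<ge> 0"
        using cu by (auto simp: W_def)
      then show ?thesis using W[of "c * s"] cu by (simp add: algebra_simps)
    qed
    moreover have "r \<le> q m" if "(m, r) \<in> W" for m r
      using that sublinear_scale[OF q] by (auto simp: W_def)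
    ultimately obtain r where "sublinear r" "\<And>x. r x \<le> q x"
      and r: "\<And>m t. (m, t) \<in> W \<Longrightarrow> r (- m) \<le> - t"
      using sublinear_below_cone[OF q, of W] by blast
    then have "r = q" using min by (simp add: le_fun_def)
    then have "q (- a) \<le> - q a" using r[of a "q a"] W[of 1] by simp
    with sublinear_neg_ge[OF q, of a] show ?thesis by simp
  qed
  show ?thesis
  proof (rule linearI)
    fix x y
    \<comment> \<open>By oddness, subadditivity at the negatives is superadditivity at
      \<open>x\<close> and \<open>y\<close>.\<close>
    have "q (- x + - y) \<le> q (- x) + q (- y)" using sublinear_add[OF q] .
    then have "q x + q y \<le> q (x + y)"
      using neg[of x] neg[of y] neg[of "x + y"] by simp
    with sublinear_add[OF q, of x y] show "q (x + y) = q x + q y" by simp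
  next
    fix c x
    show "q (c *\<^sub>R x) = c *\<^sub>R q x"
    proof (cases "c \<ge> 0")
      case True
      then show ?thesis using sublinear_scale[OF q] by simp
    next
      case False
      then show ?thesis using sublinear_scale[OF q, of "- c" x] neg[of "c *\<^sub>R x"] by simp
    qed
  qed
qed

lemma linear_below_sublinear:
  fixes p :: "'a::real_vector \<Rightarrow> real"
  assumes "sublinear p"
  obtains f where "linear f" "f \<le> p"
proof -
  define S where "S = {q. sublinear q \<and> q \<le> p}"
  have "\<exists>m\<in>S. \<forall>q\<in>S. q \<le> m \<longrightarrow> q = m"
  proof (rule predicate_Zorn)
    \<comment> \<open>The order is reversed, so that Zorn's lemma yields a minimal element and
      chains need lower bounds; the empty chain has \<open>p\<close> itself.\<close>
    show "partial_order_on S (relation_of (\<lambda>x y. y \<le> x) S)"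
      by (rule partial_order_on_relation_ofI) auto
  next
    fix C assume C: "C \<in> Chains (relation_of (\<lambda>x y. y \<le> x) S)"
    then have CS: "C \<subseteq> S" by (rule Chains_relation_of)
    show "\<exists>u\<in>S. \<forall>a\<in>C. u \<le> a"
    proof (cases "C = {}")
      case True
      then show ?thesis using assms by (auto simp: S_def)
    next
      case False
      have "q \<le> r \<or> r \<le> q" if "q \<in> C" "r \<in> C" for q r
        using C that by (auto simp: Chains_def relation_of_def)
      moreover have "sublinear q" "q \<le> p" if "q \<in> C" for q
        using CS that by (auto simp: S_def)
      ultimately obtain g where "sublinear g" "\<And>q. q \<in> C \<Longrightarrow> g \<le> q"
        using sublinear_INF_chain[of C p] False by metis
      moreover from this have "g \<le> p"
        using False \<open>\<And>q. q \<in> C \<Longrightarrow> q \<le> p\<close> by (meson ex_in_conv order_trans)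
      ultimately show ?thesis unfolding S_def by blast
    qed
  qed
  then obtain m where m: "m \<in> S" "\<And>q. q \<in> S \<Longrightarrow> q \<le> m \<Longrightarrow> q = m" by blast
  then have "linear m"
    by (intro linear_if_minimal_sublinear) (auto simp: S_def intro: order_trans)
  with m that show ?thesis by (auto simp: S_def)
qed

text \<open>The functional to be extended is given by its graph \<open>W\<close>; the bound makes \<open>W\<close> single-valued.\<close>

theorem Hahn_Banach_graph:
  fixes W :: "('a::real_normed_vector \<times> real) set"
  assumes W: "subspace W" and le: "\<And>m r. (m, r) \<in> W \<Longrightarrow> r \<le> norm m"
  obtains f :: "'a \<Rightarrow>\<^sub>L real" where "norm f \<le> 1" "\<And>m r. (m, r) \<in> W \<Longrightarrow> f m = r"
proof -
  obtain q where q: "sublinear q" "\<And>x. q x \<le> norm x" "\<And>m r. (m, r) \<in> W \<Longrightarrow> q (- m) \<le> - r"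
  proof (rule sublinear_below_cone[OF sublinear_norm, of W])
    show "(0, 0) \<in> W" using subspace_0[OF W] by (simp add: zero_prod_def)
  qed (use W le in \<open>auto simp: subspace_add subspace_scale\<close>)
  obtain g where g: "linear g" "g \<le> q" using linear_below_sublinear[OF q(1)] .
  have g_le: "g x \<le> norm x" for x
    using le_funD[OF g(2), of x] q(2)[of x] by simp
  have g_abs: "\<bar>g x\<bar> \<le> norm x" for x
    using g_le[of x] g_le[of "- x"] linear_neg[OF g(1), of x] by simp
  have "bounded_linear g"
    using g(1) g_abs by (intro linear_conv_bounded_linear[THEN iffD1] bounded_linear.intro
        bounded_linear_axioms.intro exI[of _ 1]) auto
  then have f: "blinfun_apply (Blinfun g) = g" by (rule bounded_linear_Blinfun_apply)
  have "norm (Blinfun g) \<le> 1"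
    using g_abs by (intro norm_blinfun_bound) (auto simp: f)
  moreover have "Blinfun g m = r" if mr: "(m, r) \<in> W" for m r
  proof -
    \<comment> \<open>The bound on \<open>q\<close> at both \<open>(m, r)\<close> and its negative
      squeezes \<open>g m\<close> to \<open>r\<close>.\<close>
    have "(- m, - r) \<in> W" using subspace_neg[OF W mr] by simp
    then have "g m \<le> r" using q(3) le_funD[OF g(2), of m] by fastforce
    moreover have "g (- m) \<le> - r" using q(3)[OF mr] le_funD[OF g(2), of "- m"] by simp
    ultimately show ?thesis using linear_neg[OF g(1), of m] by (simp add: f)
  qed
  ultimately show ?thesis by (rule that)
qed

section \<open>Norming functionals and separation of points\<close>

lemma norming_functional:
  fixes y :: "'a::real_normed_vector"
  obtains f :: "'a \<Rightarrow>\<^sub>L real" where "norm f \<le> 1" "f y = norm y"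
proof -
  \<comment> \<open>The graph of \<open>t y \<mapsto> t * norm y\<close> on the line through
    \<open>y\<close>; for \<open>y = 0\<close> it shrinks to the origin.\<close>
  define W where "W = range (\<lambda>t. (t *\<^sub>R y, t * norm y))"
  have "linear (\<lambda>t. (t *\<^sub>R y, t * norm y))"
    by (rule linearI) (auto simp: algebra_simps)
  then have "subspace W" unfolding W_def by (rule linear_subspace_image) simp
  moreover have "r \<le> norm m" if "(m, r) \<in> W" for m r
    using that by (auto simp: W_def mult_right_mono)
  moreover have "(y, norm y) \<in> W" unfolding W_def by (rule range_eqI[of _ _ 1]) simp
  ultimately show ?thesis using that by (metis Hahn_Banach_graph)
qed

lemma eq_if_functionals_eq:
  fixes x y :: "'a::real_normed_vector"
  assumes "\<And>f :: 'a \<Rightarrow>\<^sub>L real. f x = f y"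
  shows "x = y"
proof -
  obtain f :: "'a \<Rightarrow>\<^sub>L real" where "f (x - y) = norm (x - y)"
    using norming_functional[of "x - y"] by blast
  then show ?thesis using assms[of f] by (simp add: blinfun.diff_right)
qed

section \<open>Semi-inner-products with a prescribed support functional\<close>

text \<open>Lumer's construction: choose a norming functional \<open>F w\<close> for each unit
  vector \<open>w\<close> and let the product of \<open>x\<close> with \<open>c w\<close> be
  \<open>c * F w x\<close>. Choosing \<open>f\<close> at \<open>y\<close> prescribes the product
  there.\<close>

lemma compatible_sip_with_support_functional:
  fixes y :: "'a::real_normed_vector" and f :: "'a \<Rightarrow>\<^sub>L real"
  assumes y: "norm y = 1" and f: "norm f \<le> 1" "f y = 1"
  obtains s where "s \<in> compatible_sips" "\<And>x. s x y = f x"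
proof -
  have "\<exists>F :: 'a \<Rightarrow> ('a \<Rightarrow>\<^sub>L real). \<forall>v. norm (F v) \<le> 1 \<and> blinfun_apply (F v) v = norm v"
    by (metis norming_functional)
  then obtain F0 :: "'a \<Rightarrow> ('a \<Rightarrow>\<^sub>L real)" where F0: "\<And>v. norm (F0 v) \<le> 1" "\<And>v. blinfun_apply (F0 v) v = norm v"
    by blast
  \<comment> \<open>The line through \<open>y\<close> may end up represented by \<open>- y\<close>,
    so \<open>F\<close> is prescribed at both points.\<close>
  define F where "F v = (if v = y then f else if v = - y then - f else F0 v)" for v
  have F: "norm (F v) \<le> 1" "blinfun_apply (F v) v = norm v" for v
    using F0 f y by (auto simp: F_def blinfun.minus_left blinfun.minus_right)
  define dirs where "dirs v = {w. norm w = 1 \<and> (\<exists>c. v = c *\<^sub>R w)}" for v :: 'a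
  \<comment> \<open>One unit vector is chosen per line, so that \<open>rep v = rep (- v)\<close>; this is what makes
    \<open>s\<close> homogeneous in its second argument.\<close>
  define rep where "rep v = (SOME w. w \<in> dirs v)" for v :: 'a
  \<comment> \<open>If \<open>v = c w\<close> with \<open>w = rep v\<close>, the first factor equals
    \<open>c\<close>, because \<open>F w\<close> takes the value 1 at \<open>w\<close>.\<close>
  define s where "s x v = blinfun_apply (F (rep v)) v * blinfun_apply (F (rep v)) x" for x v
  have dirs_scale: "dirs (a *\<^sub>R v) = dirs v" if "a \<noteq> 0" for a v
  proof -
    have "(\<exists>c. a *\<^sub>R v = c *\<^sub>R w) \<longleftrightarrow> (\<exists>c. v = c *\<^sub>R w)" for w
    proof
      assume "\<exists>c. a *\<^sub>R v = c *\<^sub>R w"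
      then obtain c where "a *\<^sub>R v = c *\<^sub>R w" ..
      then have "inverse a *\<^sub>R (a *\<^sub>R v) = (inverse a * c) *\<^sub>R w" by simp
      then show "\<exists>c. v = c *\<^sub>R w" using that by auto
    qed (metis scaleR_scaleR)
    then show ?thesis by (simp add: dirs_def)
  qed
  have rep_scale: "rep (a *\<^sub>R v) = rep v" if "a \<noteq> 0" for a v
    using dirs_scale[OF that] by (simp add: rep_def)
  have ex_rep: "norm (rep v) = 1 \<and> (\<exists>c. v = c *\<^sub>R rep v)" for v
  proof -
    \<comment> \<open>Every unit vector spans a line through 0, so \<open>y\<close> can serve as the
      witness for \<open>v = 0\<close>.\<close>
    have "(if v = 0 then y else v /\<^sub>R norm v) \<in> dirs v"
    proof (cases "v = 0")
      case True
      then show ?thesis using y by (auto simp: dirs_def intro: exI[of _ 0])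
    next
      case False
      then show ?thesis by (auto simp: dirs_def intro!: exI[of _ "norm v"])
    qed
    then have "rep v \<in> dirs v" unfolding rep_def by (rule someI)
    then show ?thesis by (simp add: dirs_def)
  qed
  have coeff: "\<bar>blinfun_apply (F (rep v)) v\<bar> = norm v" for v
  proof -
    obtain c where "v = c *\<^sub>R rep v" "norm (rep v) = 1" using ex_rep by blast
    moreover from this have "blinfun_apply (F (rep v)) v = c"
      using F(2)[of "rep v"] blinfun.scaleR_right[of "F (rep v)" c "rep v"] by simp
    ultimately show ?thesis by (metis norm_scaleR mult.right_neutral)
  qed
  have self: "s v v = (norm v)\<^sup>2" for v
    using coeff[of v] by (metis s_def power2_abs power2_eq_square)
  have bound: "\<bar>s x v\<bar> \<le> norm x * norm v" for x v
  proof -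
    have "\<bar>blinfun_apply (F (rep v)) x\<bar> \<le> norm (F (rep v)) * norm x"
      using norm_blinfun[of "F (rep v)" x] by simp
    also have "\<dots> \<le> norm x" using F(1)[of "rep v"] by (simp add: mult_left_le_one_le)
    finally show ?thesis
      by (simp add: s_def abs_mult coeff mult.commute mult_left_mono)
  qed
  have "\<bar>s x v\<bar>\<^sup>2 \<le> s x x * s v v" for x v
    using power_mono[OF bound, of x v 2] by (simp add: self power_mult_distrib)
  moreover have "s x (a *\<^sub>R v) = a * s x v" for a x v
    by (cases "a = 0") (simp_all add: s_def rep_scale blinfun.scaleR_right blinfun.zero_right)
  moreover have "s (a *\<^sub>R x + b *\<^sub>R z) v = a * s x v + b * s z v" for a b x z v
    by (simp add: s_def blinfun.add_right blinfun.scaleR_right algebra_simps)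
  ultimately have "s \<in> compatible_sips"
    using self by (simp add: compatible_sips_def semi_inner_product_def)
  moreover have "s x y = f x" for x
  proof -
    obtain c where c: "y = c *\<^sub>R rep y" "norm (rep y) = 1" using ex_rep by blast
    then have "\<bar>c\<bar> = 1" using y by (metis norm_scaleR mult.right_neutral)
    then have "c = 1 \<or> c = - 1" by linarith
    then have "rep y = y \<or> rep y = - y" using c by (metis scaleR_one scaleR_minus1_left minus_minus)
    \<comment> \<open>If \<open>rep y = - y\<close>, both factors of \<open>s\<close> change sign
      and the product is still \<open>f x\<close>.\<close>
    then show ?thesis using f
      by (auto simp: s_def F_def blinfun.minus_left)
  qed
  ultimately show ?thesis by (rule that)
qed

lemma compatible_sip_le:
  assumes "s \<in> compatible_sips"
  shows "s x y \<le> norm x * norm y"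
proof -
  have "\<bar>s x y\<bar>\<^sup>2 \<le> (norm x * norm y)\<^sup>2"
    using assms by (auto simp: compatible_sips_def semi_inner_product_def power_mult_distrib)
  then have "\<bar>s x y\<bar> \<le> norm x * norm y" by (rule power2_le_imp_le) simp
  then show ?thesis by simp
qed

section \<open>Norm attainment of compact operators\<close>

text \<open>The image of a bounded set lies in a continuous image of a product of two compact
  sets.\<close>

lemma compact_operator_add_scaleR:
  fixes T A :: "'a::real_normed_vector \<Rightarrow>\<^sub>L 'b::real_normed_vector"
  assumes "compact_operator T" "compact_operator A"
  shows "compact_operator (T + c *\<^sub>R A)"
  unfolding compact_operator_def
proof (intro allI impI)
  fix S :: "'a set" assume "bounded S"
  define K where "K = (\<lambda>(u, v). u + c *\<^sub>R v) ` (closure (T ` S) \<times> closure (A ` S))"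
  have "compact K"
    unfolding K_def case_prod_unfold
    using assms \<open>bounded S\<close>
    by (intro compact_continuous_image compact_Times continuous_intros)
      (auto simp: compact_operator_def)
  moreover have "(T + c *\<^sub>R A) ` S \<subseteq> K"
    using closure_subset by (fastforce simp: K_def blinfun.add_left blinfun.scaleR_left)
  ultimately have "closure ((T + c *\<^sub>R A) ` S) \<subseteq> K"
    by (intro closure_minimal compact_imp_closed)
  then show "compact (closure ((T + c *\<^sub>R A) ` S))"
    using compact_Int_closed[OF \<open>compact K\<close> closed_closure] by (metis inf.absorb2)
qed

lemma reflexive_compact_operator_limit:
  fixes T :: "'a::real_normed_vector \<Rightarrow>\<^sub>L 'b::real_normed_vector"
  assumes refl: "reflexive_space TYPE('a)"
    and x: "\<And>n. norm (x n) \<le> 1" and lim: "(\<lambda>n. T (x n)) \<longlonglongrightarrow> z"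
  obtains x0 where "norm x0 \<le> 1" "T x0 = z"
proof -
  \<comment> \<open>Different \<open>g\<close> may have the same composite with \<open>T\<close>; as
    a relation, \<open>W\<close> can be used before this is known to be harmless.\<close>
  define W where "W = range (\<lambda>g :: 'b \<Rightarrow>\<^sub>L real. (g o\<^sub>L T, g z))"
  have "linear (\<lambda>g :: 'b \<Rightarrow>\<^sub>L real. (g o\<^sub>L T, g z))"
    by (rule linearI)
      (auto intro!: blinfun_eqI simp: blinfun.add_left blinfun.scaleR_left)
  then have "subspace W" unfolding W_def by (rule linear_subspace_image) simp
  moreover have "r \<le> norm m" if "(m, r) \<in> W" for m r
  proof -
    obtain g where g: "m = g o\<^sub>L T" "r = g z" using \<open>(m, r) \<in> W\<close> by (auto simp: W_def)
    have lim_m: "(\<lambda>n. m (x n)) \<longlonglongrightarrow> r"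
      unfolding g using lim by (auto intro!: tendsto_intros)
    \<comment> \<open>The bound survives the limit because every \<open>x n\<close> lies in the unit
      ball.\<close>
    have "m (x n) \<le> norm m" for n
      using norm_blinfun[of m "x n"] mult_left_mono[OF x, of "norm m" n] by simp
    then show ?thesis by (intro LIMSEQ_le_const2[OF lim_m]) auto
  qed
  ultimately obtain \<phi> :: "('a \<Rightarrow>\<^sub>L real) \<Rightarrow>\<^sub>L real"
    where phi: "norm \<phi> \<le> 1" "\<And>m r. (m, r) \<in> W \<Longrightarrow> \<phi> m = r"
    using Hahn_Banach_graph by metis
  obtain x0 where x0: "\<phi> = bidual_embedding x0"
    using refl by (metis reflexive_space_def surjE)
  have phi_eq: "\<phi> h = h x0" for h
    by (simp add: x0 bidual_embedding.rep_eq)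
  show ?thesis
  proof
    \<comment> \<open>Testing \<open>\<phi>\<close> on a functional norming \<open>x0\<close> bounds
      \<open>norm x0\<close> by \<open>norm \<phi>\<close>.\<close>
    obtain h :: "'a \<Rightarrow>\<^sub>L real" where h: "norm h \<le> 1" "h x0 = norm x0"
      using norming_functional .
    have "norm x0 \<le> norm \<phi> * norm h"
      using norm_blinfun[of \<phi> h] by (simp add: phi_eq h)
    also have "\<dots> \<le> 1" using phi(1) h(1) by (simp add: mult_le_one)
    finally show "norm x0 \<le> 1" .
    show "T x0 = z"
    proof (rule eq_if_functionals_eq)
      fix g :: "'b \<Rightarrow>\<^sub>L real"
      have "\<phi> (g o\<^sub>L T) = g z" by (rule phi(2)) (simp add: W_def)
      then show "g (T x0) = g z" by (simp add: phi_eq)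
    qed
  qed
qed

text \<open>Images of a maximising sequence subconverge to some \<open>z\<close> with
  \<open>norm z = norm T\<close>, and \<open>z\<close> is the image of a point of the ball. For
  nonzero \<open>T\<close> this point must have norm 1; the zero operator is treated apart.\<close>

lemma compact_operator_attains_norm:
  fixes T :: "'a::real_normed_vector \<Rightarrow>\<^sub>L 'b::real_normed_vector"
  assumes nontriv: "UNIV \<noteq> {0::'a}" and refl: "reflexive_space TYPE('a)"
    and T: "compact_operator T"
  obtains x where "norm x = 1" "norm (T x) = norm T"
proof (cases "T = 0")
  case True
  obtain v :: 'a where "v \<noteq> 0" using nontriv by blast
  then have "norm (v /\<^sub>R norm v) = 1" by simp
  from that[OF this] show ?thesis using True by simp
next
  case False
  have "\<exists>x. norm x \<le> 1 \<and> norm T - inverse (real (Suc n)) < norm (T x)" for n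
  proof (rule ccontr)
    assume "\<not> ?thesis"
    then have le: "norm (T x) \<le> norm T - inverse (real (Suc n))" if "norm x \<le> 1" for x
      using that by (meson not_le)
    \<comment> \<open>Evaluating at 0 supplies the nonnegativity that
      \<open>norm_blinfun_bound\<close> asks of its constant.\<close>
    then have nonneg: "0 \<le> norm T - inverse (real (Suc n))"
      using le[of 0] by simp
    have "norm T \<le> norm T - inverse (real (Suc n))"
    proof (rule norm_blinfun_bound[OF nonneg])
      fix x
      show "norm (T x) \<le> (norm T - inverse (real (Suc n))) * norm x"
        using le[of "x /\<^sub>R norm x"]
        by (cases "x = 0") (auto simp: blinfun.scaleR_right field_simps)
    qed
    then show False by simp
  qed
  then obtain x where x: "\<And>n. norm (x n) \<le> 1" "\<And>n. norm T - inverse (real (Suc n)) < norm (T (x n))"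
    by metis
  have "compact (closure (T ` cball 0 1))"
    using T by (simp add: compact_operator_def)
  then have "seq_compact (closure (T ` cball 0 1))"
    by (simp add: compact_eq_seq_compact_metric)
  moreover have "\<forall>n. T (x n) \<in> closure (T ` cball 0 1)"
    using x(1) closure_subset by (fastforce simp: dist_norm)
  ultimately obtain z k where k: "strict_mono k" "(\<lambda>n. T (x (k n))) \<longlonglongrightarrow> z"
    by (elim seq_compactE) (auto simp: comp_def)
  have "(\<lambda>n. norm (T (x n))) \<longlonglongrightarrow> norm T"
  proof (rule real_tendsto_sandwich)
    show "(\<lambda>n. norm T + - inverse (real (Suc n))) \<longlonglongrightarrow> norm T"
      by (rule LIMSEQ_inverse_real_of_nat_add_minus)
    show "(\<lambda>n. norm T) \<longlonglongrightarrow> norm T" by (rule tendsto_const)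
    show "\<forall>\<^sub>F n in sequentially. norm T + - inverse (real (Suc n)) \<le> norm (T (x n))"
      using x(2) by (intro always_eventually allI less_imp_le) simp
    have "norm (T (x n)) \<le> norm T" for n
      using norm_blinfun[of T "x n"] mult_left_mono[OF x(1), of "norm T" n] by simp
    then show "\<forall>\<^sub>F n in sequentially. norm (T (x n)) \<le> norm T" by simp
  qed
  from LIMSEQ_subseq_LIMSEQ[OF this k(1)]
  have "(\<lambda>n. norm (T (x (k n)))) \<longlonglongrightarrow> norm T" by (simp add: comp_def)
  then have z: "norm z = norm T"
    using tendsto_norm[OF k(2)] LIMSEQ_unique by blast
  obtain x0 where x0: "norm x0 \<le> 1" "T x0 = z"
    using reflexive_compact_operator_limit[OF refl _ k(2)] x(1) by blast
  have "norm T \<le> norm T * norm x0" using norm_blinfun[of T x0] z x0 by simp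
  then have "norm x0 = 1" using x0(1) False by (simp add: mult_le_cancel_left1)
  then show ?thesis using that x0 z by blast
qed

section \<open>Orthogonality and the constrained supremum\<close>

lemma orthogonal_near_norming:
  fixes T A :: "'a::real_normed_vector \<Rightarrow>\<^sub>L 'b::real_normed_vector"
  assumes X: "UNIV \<noteq> {0::'a}" and Y: "UNIV \<noteq> {0::'b}" and refl: "reflexive_space TYPE('a)"
    and TA: "compact_operator T" "compact_operator A" "T \<bottom>\<^sub>B A" and e: "e > 0"
  obtains s x y where "norm x = 1" "norm y = 1" "s \<in> compatible_sips"
    "s (A x) y \<ge> 0" "norm T - e < s (T x) y"
proof -
  \<comment> \<open>Adding 1 keeps the denominator positive when \<open>A = 0\<close> and makes
    \<open>c * norm A < e\<close> strict.\<close>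
  define c where "c = e / (norm A + 1)"
  have pos: "norm A + 1 > 0" by (simp add: add_nonneg_pos)
  then have c: "c > 0" "c * norm A < e"
    using e by (simp_all add: c_def pos_divide_less_eq algebra_simps)
  define B where "B = T + c *\<^sub>R A"
  obtain x where x: "norm x = 1" "norm (B x) = norm B"
    using compact_operator_attains_norm[OF X refl] compact_operator_add_scaleR[OF TA(1,2)]
    unfolding B_def by blast
  obtain v :: 'b where "v \<noteq> 0" using Y by blast
  \<comment> \<open>\<open>B x\<close> vanishes when \<open>B = 0\<close>; then any unit vector
    \<open>y\<close> satisfies \<open>norm (B x) *\<^sub>R y = B x\<close>.\<close>
  define w where "w = (if B x = 0 then v else B x)"
  define y where "y = w /\<^sub>R norm w"
  have y: "norm y = 1" "norm (B x) *\<^sub>R y = B x"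
    using \<open>v \<noteq> 0\<close> by (auto simp: y_def w_def)
  obtain f :: "'b \<Rightarrow>\<^sub>L real" where f: "norm f \<le> 1" "f y = 1"
    using norming_functional[of y] y by metis
  obtain s where s: "s \<in> compatible_sips" "\<And>x. s x y = f x"
    using compatible_sip_with_support_functional[OF y(1) f] by blast
  have f_le: "f u \<le> norm u" for u
    using compatible_sip_le[OF s(1), of u y] s(2) y(1) by simp
  have "f (B x) = norm B"
    using blinfun.scaleR_right[of f "norm (B x)" y] y(2) f(2) x(2) by simp
  then have sum: "f (T x) + c * f (A x) = norm B"
    by (simp add: B_def blinfun.add_left blinfun.add_right blinfun.scaleR_left blinfun.scaleR_right)
  have TB: "norm T \<le> norm B"
    using TA(3) by (simp add: B_def birkhoff_james_orthogonal_def)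
  have "f (T x) \<le> norm T"
    using f_le[of "T x"] norm_blinfun[of T x] x(1) by simp
  \<comment> \<open>Here
    \<open>f (T x) \<le> norm T \<le> norm B = f (T x) + c * f (A x)\<close>.\<close>
  then have "0 \<le> c * f (A x)" using sum TB by simp
  then have "f (A x) \<ge> 0" using c(1) by (simp add: zero_le_mult_iff)
  moreover have "f (A x) \<le> norm A"
    using f_le[of "A x"] norm_blinfun[of A x] x(1) by simp
  then have "c * f (A x) \<le> c * norm A" using c(1) by (intro mult_left_mono) auto
  then have "norm T - e < f (T x)" using sum TB c(2) by simp
  ultimately show ?thesis using that x(1) y(1) s by metis
qed

text \<open>The Cauchy-Schwarz inequality bounds the set by \<open>norm T\<close>, and
  \<open>orthogonal_near_norming\<close> comes within any \<open>e > 0\<close> of it.\<close>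

lemma orthogonal_norm_eq_Sup:
  fixes T A :: "'a::real_normed_vector \<Rightarrow>\<^sub>L 'b::real_normed_vector"
  assumes "UNIV \<noteq> {0::'a}" and "UNIV \<noteq> {0::'b}" and "reflexive_space TYPE('a)"
    and "compact_operator T" "compact_operator A" "T \<bottom>\<^sub>B A"
  shows "norm T = Sup {s (T x) y | s x y. x \<in> sphere 0 1 \<and> y \<in> sphere 0 1 \<and>
    s \<in> compatible_sips \<and> s (A x) y \<ge> 0}" (is "_ = Sup ?S")
proof -
  have near: "\<exists>a\<in>?S. norm T - e < a" if "e > 0" for e
    using orthogonal_near_norming[OF assms that] by (smt (verit) mem_Collect_eq mem_sphere_0)
  have "Sup ?S = norm T"
  proof (rule cSup_eq_non_empty)
    show "?S \<noteq> {}" using near[OF zero_less_one] by (metis empty_iff)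
  next
    fix a assume "a \<in> ?S"
    then obtain s x y where "a = s (T x) y" "norm x = 1" "norm y = 1" "s \<in> compatible_sips"
      by auto
    then show "a \<le> norm T"
      using compatible_sip_le[of s "T x" y] norm_blinfun[of T x] by simp
  next
    fix b assume b: "\<And>a. a \<in> ?S \<Longrightarrow> a \<le> b"
    show "norm T \<le> b"
    proof (rule field_le_epsilon)
      fix e :: real assume "e > 0"
      then obtain a where "a \<in> ?S" "norm T - e < a" by (rule bexE[OF near])
      then show "norm T \<le> b + e" using b[of a] by linarith
    qed
  qed
  then show ?thesis by simp
qed

theorem theorem2p5:
  fixes T A :: "'a::banach \<Rightarrow>\<^sub>L 'b::banach"
  assumes "UNIV \<noteq> {0::'a}" and "UNIV \<noteq> {0::'b}"
    and "reflexive_space TYPE('a)"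
    and "compact_operator T" and "compact_operator A"
    and "T \<bottom>\<^sub>B A"
  shows "norm T = Sup {s (blinfun_apply T x) y | s x y.
            x \<in> sphere 0 1 \<and> y \<in> sphere 0 1 \<and> s \<in> compatible_sips \<and>
            s (blinfun_apply A x) y \<ge> 0} \<and>
         norm T = Sup {s (blinfun_apply T x) y | s x y.
            x \<in> sphere 0 1 \<and> y \<in> sphere 0 1 \<and> s \<in> compatible_sips \<and>
            s (blinfun_apply A x) y \<le> 0}"
proof
  show "norm T = Sup {s (blinfun_apply T x) y | s x y.
            x \<in> sphere 0 1 \<and> y \<in> sphere 0 1 \<and> s \<in> compatible_sips \<and>
            s (blinfun_apply A x) y \<ge> 0}"
    using orthogonal_norm_eq_Sup[OF assms] .
next
  \<comment> \<open>The second equality is the first one for \<open>- A\<close>: orthogonality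
    ranges over scalars of both signs, and the constraint changes sign.\<close>
  have neg_A: "compact_operator (- A)" "T \<bottom>\<^sub>B - A"
  proof -
    show "compact_operator (- A)"
      using compact_operator_add_scaleR[OF assms(5,5), of "-2"] by (simp add: scaleR_2)
    show "T \<bottom>\<^sub>B - A"
      using assms(6) unfolding birkhoff_james_orthogonal_def
      by (metis scaleR_minus_left scaleR_minus_right)
  qed
  have neg: "s (blinfun_apply (- A) x) y = - s (A x) y"
    if "s \<in> compatible_sips" for s :: "'b \<Rightarrow> 'b \<Rightarrow> real" and x y
  proof -
    \<comment> \<open>The zero summand fits the two-term linearity axiom.\<close>
    have "s ((-1) *\<^sub>R A x + 0 *\<^sub>R 0) y = (-1) * s (A x) y + 0 * s 0 y"
      using that unfolding compatible_sips_def semi_inner_product_def by blast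
    then show ?thesis by (simp add: blinfun.minus_left)
  qed
  \<comment> \<open>Membership of \<open>s\<close> stays in the equivalence, so that it can rewrite
    the last two conjuncts inside the set.\<close>
  have sign: "s \<in> compatible_sips \<and> s (blinfun_apply (- A) x) y \<ge> 0 \<longleftrightarrow>
      s \<in> compatible_sips \<and> s (A x) y \<le> 0" for s :: "'b \<Rightarrow> 'b \<Rightarrow> real" and x y
    using neg[of s x y] by auto
  show "norm T = Sup {s (blinfun_apply T x) y | s x y.
            x \<in> sphere 0 1 \<and> y \<in> sphere 0 1 \<and> s \<in> compatible_sips \<and>
            s (blinfun_apply A x) y \<le> 0}"
    using orthogonal_norm_eq_Sup[OF assms(1-4) neg_A] by (simp only: sign)
qed

end
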